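(* Consider the mechanical system $\mathbf M\ddot y+\mathbf C\dot y+\mathbf K y+f(y,\dot y)=\epsilon\, g(\Omega t,y,\dot y)$ with quasiperiodic forcing, its first-order form $\mathbf B\dot z=\mathbf A z+F(z)+\epsilon G(\Omega t,z)$, $z=(y,\dot y)$, and let $W_\epsilon=W(p)+\epsilon X(p,\varphi)+\cdots$ and $R_\epsilon=R(p)+\epsilon S(p,\varphi)+\cdots$ be the parametrization of a non-autonomous invariant manifold and of its reduced vector field, where $W=\begin{bmatrix}w\\ \dot w\end{bmatrix}$, $X=\begin{bmatrix}x\\ \dot x\end{bmatrix}$, and $W,R,X,S$ satisfy the invariance equations at orders $\epsilon^0$ and $\epsilon^1$: $$\mathbf B(DW(p))R(p)=\mathbf AW(p)+F(W(p)),$$ $$\mathbf B\Big(DW(p)\,S(p,\varphi)+[\partial_pX(p,\varphi)]R(p)+[\partial_\varphi X(p,\varphi)]\Omega\Big)=\mathbf A X(p,\varphi)+[DF(W(p))]X(p,\varphi)+G(\varphi,W(p)).$$ Then for every multi-index $m\in\mathbb N^M$ and harmonic $\kappa$ the coefficient of the non-autonomous velocity parametrization is obtained directly from the displacement parametrization as $$\dot x_{m,\kappa}=\big[Dw(p)\,S+(\partial_px)\,R+(\partial_\varphi x)\,\Omega\big]_{m,\kappa},$$ where $[\,\cdot\,]_{m,\kappa}$ denotes the coefficient of $e^{i\langle\kappa,\varphi\rangle}p^m$.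
   Context: $\mathbf M,\mathbf C,\mathbf K\in\mathbb R^{n\times n}$ are the mass, damping and stiffness matrices, with $\mathbf M$ nonsingular, and $$\mathbf A=\begin{bmatrix}-\mathbf K&0\\0&\mathbf M\end{bmatrix},\quad \mathbf B=\begin{bmatrix}\mathbf C&\mathbf M\\ \mathbf M&0\end{bmatrix},\quad F(z)=\begin{bmatrix}-f(y,\dot y)\\0\end{bmatrix},\quad G(\varphi,z)=\begin{bmatrix}g(\varphi,y,\dot y)\\0\end{bmatrix}.$$ $\Omega\in\mathbb R^{q}$ is the frequency vector, $\varphi=\Omega t\in\mathbb T^{q}$ the forcing phase, harmonics are $\kappa\in\mathbb Z^{q}$. The parametrization coordinates $p\in\mathbb C^M$ follow $\dot p=R_\epsilon(p,\varphi)$, $\dot\varphi=\Omega$. $w,x$ are the displacement blocks and the symbols $\dot w,\dot x$ denote the velocity blocks of $W,X$. Expansions (formal Taylor–Fourier series): $w(p)=\sum_{m\in\mathbb N^M}w_mp^m$, $\dot w(p)=\sum_m\dot w_mp^m$, $R(p)=\sum_mR_mp^m$, $x(p,\varphi)=\sum_{m,\kappa}x_{m,\kappa}e^{i\langle\kappa,\varphi\rangle}p^m$, and similarly for $\dot x$ and $S$, with $W(0)=0$, $R(0)=0$ and $p^m=p_1^{m_1}\cdots p_M^{m_M}$. $D$ denotes the derivative of a function of a single (vector) argument. *)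

theory Defs
  imports "HOL-Analysis.Analysis"
begin

subsection \<open>Block vectors and matrices\<close>

definition vstack :: "'a^'n \<Rightarrow> 'a^'k \<Rightarrow> 'a^('n + 'k)" where
  "vstack u v = (\<chi> i. case i of Inl a \<Rightarrow> u $ a | Inr b \<Rightarrow> v $ b)"

definition upper :: "'a^('n::finite + 'k::finite) \<Rightarrow> 'a^'n" where
  "upper z = (\<chi> a. z $ Inl a)"

definition lower :: "'a^('n::finite + 'k::finite) \<Rightarrow> 'a^'k" where
  "lower z = (\<chi> b. z $ Inr b)"

definition block_matrix ::
    "'a^'n^'n \<Rightarrow> 'a^'k^'n \<Rightarrow> 'a^'n^'k \<Rightarrow> 'a^'k^'k \<Rightarrow> 'a^('n + 'k)^('n + 'k)" where
  "block_matrix P Q U V =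
     (\<chi> i. case i of Inl a \<Rightarrow> vstack (P $ a) (Q $ a) | Inr b \<Rightarrow> vstack (U $ b) (V $ b))"

definition cvec :: "real^'n \<Rightarrow> complex^'n" where
  "cvec v = (\<chi> i. complex_of_real (v $ i))"

definition cmat :: "real^'n^'k \<Rightarrow> complex^'n^'k" where
  "cmat P = (\<chi> i j. complex_of_real (P $ i $ j))"


subsection \<open>The first-order form of the mechanical system\<close>

definition sysA :: "real^'n^'n \<Rightarrow> real^'n^'n \<Rightarrow> real^('n + 'n)^('n + 'n)" where
  "sysA M K = block_matrix (- K) 0 0 M"

definition sysB :: "real^'n^'n \<Rightarrow> real^'n^'n \<Rightarrow> real^('n + 'n)^('n + 'n)" where
  "sysB M C = block_matrix C M M 0"

definition sysF ::
    "(real^'n \<Rightarrow> real^'n \<Rightarrow> real^'n) \<Rightarrow> real^('n + 'n) \<Rightarrow> real^('n + 'n)" where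
  "sysF f z = vstack (- f (upper z) (lower z)) 0"

definition sysG ::
    "(real^'q \<Rightarrow> real^'n \<Rightarrow> real^'n \<Rightarrow> real^'n) \<Rightarrow> real^'q \<Rightarrow> real^('n + 'n) \<Rightarrow> real^('n + 'n)" where
  "sysG g \<phi> z = vstack (g \<phi> (upper z) (lower z)) 0"

lemma block_matrix_mult_vstack:
  fixes P :: "'a::semiring_1^'n^'n"
  shows "block_matrix P Q U V *v vstack u v = vstack (P *v u + Q *v v) (U *v u + V *v v)"
proof -
  have "(\<Sum>j\<in>UNIV. h j) = (\<Sum>a\<in>UNIV. h (Inl a)) + (\<Sum>b\<in>UNIV. h (Inr b))"
    for h :: "'n + 'b \<Rightarrow> 'a"
    by (simp add: UNIV_Plus_UNIV[symmetric] sum.Plus del: UNIV_Plus_UNIV)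
  then show ?thesis
    by (auto simp: vec_eq_iff block_matrix_def vstack_def matrix_vector_mult_def split: sum.split)
qed

text \<open>
  The first-order form says exactly that \<open>v\<close> is the velocity (\<open>y'\<close> and \<open>v'\<close> stand for the time
  derivatives) and that the second-order equation of motion holds.
\<close>

lemma first_order_form_iff:
  assumes "invertible M"
  shows "sysB M C *v vstack y' v' =
           sysA M K *v vstack y v + sysF f (vstack y v) + \<epsilon> *\<^sub>R sysG g \<phi> (vstack y v)
         \<longleftrightarrow> y' = v \<and> M *v v' + C *v y' + K *v y + f y v = \<epsilon> *\<^sub>R g \<phi> y v"
proof -
  have inj: "M *v a = M *v b \<longleftrightarrow> a = b" for a b
    using assms by (metis inj_matrix_vector_mult injD)
  have [simp]: "upper (vstack y v) = y" "lower (vstack y v) = v"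
    by (simp_all add: upper_def lower_def vstack_def vec_eq_iff)
  have add: "vstack a b + vstack c d = vstack (a + c) (b + d)"
    and scale: "r *\<^sub>R vstack a b = vstack (r *\<^sub>R a) (r *\<^sub>R b)" for a b c d :: "real^'a" and r
    by (auto simp: vec_eq_iff vstack_def split: sum.split)
  have eq: "vstack a b = vstack c d \<longleftrightarrow> a = c \<and> b = d" for a b c d :: "real^'a"
    unfolding vec_eq_iff vstack_def by (auto simp: split_sum_all)
  have neg: "- K *v y = - (K *v y)"
    by (simp add: vec_eq_iff matrix_vector_mult_def sum_negf)
  show ?thesis
    by (auto simp: sysA_def sysB_def sysF_def sysG_def block_matrix_mult_vstack add scale eq inj neg
        algebra_simps)
qed


subsection \<open>Formal Taylor series and Taylor--Fourier series\<close>

text \<open>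
  A formal Taylor series in \<open>p\<close> is the function sending a multi-index \<open>m\<close> to its coefficient of
  \<open>p\<^sup>m\<close>. A formal Taylor--Fourier series sends a harmonic \<open>\<kappa>\<close> to the formal Taylor series that
  multiplies \<open>e\<^sup>i\<^sup>\<langle>\<^sup>\<kappa>\<^sup>,\<^sup>\<phi>\<^sup>\<rangle>\<close>, so \<open>x \<kappa> m\<close> is the coefficient of \<open>e\<^sup>i\<^sup>\<langle>\<^sup>\<kappa>\<^sup>,\<^sup>\<phi>\<^sup>\<rangle> p\<^sup>m\<close>.
  Every product below has a factor that does not depend on \<open>\<phi>\<close>, hence acts on each harmonic
  separately and only involves finite sums.
\<close>

definition splits :: "nat^'m \<Rightarrow> ((nat^'m) \<times> (nat^'m)) set" where
  "splits m = {(k, l). k + l = m}"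

lemma finite_splits: "finite (splits (m :: nat^'m))"
proof -
  let ?S = "{k :: nat^'m. \<forall>i. k $ i \<in> {..m $ i}}"
  have "finite ?S"
  proof (rule finite_subset)
    show "?S \<subseteq> (\<lambda>h. \<chi> i. h i) ` (\<Pi>\<^sub>E i\<in>UNIV. {..m $ i})"
      by (force intro: image_eqI[where x = "($) k" for k] simp: vec_eq_iff)
  qed (simp add: finite_PiE)
  moreover have "splits m \<subseteq> ?S \<times> ?S"
    by (auto simp: splits_def)
  ultimately show ?thesis
    by (meson finite_SigmaI finite_subset)
qed

definition tmult :: "(nat^'m \<Rightarrow> complex) \<Rightarrow> (nat^'m \<Rightarrow> complex) \<Rightarrow> nat^'m \<Rightarrow> complex" where
  "tmult a b m = (\<Sum>(k, l)\<in>splits m. a k * b l)"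

definition tmatvec ::
    "(nat^'m \<Rightarrow> complex^'b^'a) \<Rightarrow> (nat^'m \<Rightarrow> complex^'b) \<Rightarrow> nat^'m \<Rightarrow> complex^'a"
    (infixr "\<star>" 70) where
  "(P \<star> v) m = (\<Sum>(k, l)\<in>splits m. P k *v v l)"

text \<open>Termwise \<open>\<partial>\<^sub>p\<close> and \<open>\<partial>\<^sub>\<phi>\<close>, as Jacobian matrices.\<close>

definition Dp :: "(nat^'m \<Rightarrow> complex^'a) \<Rightarrow> nat^'m \<Rightarrow> complex^'m^'a" where
  "Dp w m = (\<chi> i j. of_nat (m $ j + 1) * w (m + axis j 1) $ i)"

definition Dphi ::
    "(int^'q \<Rightarrow> nat^'m \<Rightarrow> complex^'a) \<Rightarrow> int^'q \<Rightarrow> nat^'m \<Rightarrow> complex^'q^'a" where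
  "Dphi x \<kappa> m = (\<chi> i j. \<i> * of_int (\<kappa> $ j) * x \<kappa> m $ i)"


subsection \<open>Formal composition of a function with a Taylor series\<close>

definition pd :: "'v \<Rightarrow> (real^'v \<Rightarrow> real) \<Rightarrow> real^'v \<Rightarrow> real" where
  "pd j h z = deriv (\<lambda>t. h (z + t *\<^sub>R axis j 1)) 0"

text \<open>
  Partial derivatives, and hence the expansions below, are meaningful for functions that are smooth
  near \<open>0\<close>; as usual \<open>deriv\<close> is unspecified where the derivative does not exist.
\<close>

text \<open>The iterated partial derivative \<open>\<partial>\<^bsub>i\<^sub>1\<^esub> \<dots> \<partial>\<^bsub>i\<^sub>r\<^esub> h\<close> along the list \<open>[i\<^sub>1, \<dots>, i\<^sub>r]\<close>.\<close>

definition pds :: "'v list \<Rightarrow> (real^'v \<Rightarrow> real) \<Rightarrow> real^'v \<Rightarrow> real" where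
  "pds is h = foldr pd is h"

text \<open>The formal product \<open>W\<^bsub>i\<^sub>1\<^esub> \<cdots> W\<^bsub>i\<^sub>r\<^esub>\<close> of components of \<open>W\<close>.\<close>

fun tprod :: "'v list \<Rightarrow> (nat^'m \<Rightarrow> complex^'v) \<Rightarrow> nat^'m \<Rightarrow> complex" where
  "tprod [] W = (\<lambda>m. if m = 0 then 1 else 0)"
| "tprod (i # is) W = tmult (\<lambda>m. W m $ i) (tprod is W)"

text \<open>
  The formal series \<open>\<Sum>\<^sub>r 1/r! \<Sum>\<^bsub>i\<^sub>1,\<dots>,i\<^sub>r\<^esub> c [i\<^sub>1,\<dots>,i\<^sub>r] W\<^bsub>i\<^sub>1\<^esub> \<cdots> W\<^bsub>i\<^sub>r\<^esub>\<close>; with \<open>c\<close> the iterated partial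
  derivatives of a function at \<open>0\<close> it is the Taylor expansion of that function at \<open>0\<close>, evaluated at
  \<open>W\<close>. For \<open>W(0) = 0\<close> the terms with \<open>r > |m|\<close> do not contribute to the coefficient of \<open>p\<^sup>m\<close>
  (lemma \<open>tprod_eq_0\<close>), so cutting the sum off at \<open>|m|\<close> loses nothing.
\<close>

definition tcompose ::
    "('v::finite list \<Rightarrow> complex) \<Rightarrow> (nat^'m \<Rightarrow> complex^'v) \<Rightarrow> nat^'m \<Rightarrow> complex" where
  "tcompose c W m =
     (\<Sum>is | length is \<le> (\<Sum>j\<in>UNIV. m $ j). c is / fact (length is) * tprod is W m)"

lemma finite_tcompose_index: "finite {is :: 'v::finite list. length is \<le> r}"
  using finite_lists_length_le[of "UNIV :: 'v set" r] by simp

lemma tprod_eq_0: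
  assumes "W 0 = 0" "(\<Sum>j\<in>UNIV. m $ j) < length is"
  shows "tprod is W m = 0"
  using assms(2)
proof (induction "is" arbitrary: m)
  case (Cons i "is")
  have "W k $ i * tprod is W l = 0" if "k + l = m" for k l
  proof (cases "k = 0")
    case False
    then obtain j where "k $ j \<noteq> 0"
      by (auto simp: vec_eq_iff)
    then have "0 < (\<Sum>j\<in>UNIV. k $ j)"
      by (metis UNIV_I bot_nat_0.not_eq_extremum finite sum_eq_0_iff)
    moreover have "(\<Sum>j\<in>UNIV. m $ j) = (\<Sum>j\<in>UNIV. k $ j) + (\<Sum>j\<in>UNIV. l $ j)"
      using that by (auto simp: sum.distrib)
    ultimately show ?thesis
      using Cons by simp
  qed (simp add: assms)
  then show ?case
    by (auto simp: tmult_def splits_def intro!: sum.neutral)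
qed simp

definition compose_fun ::
    "(real^'v \<Rightarrow> real^'a) \<Rightarrow> (nat^'m \<Rightarrow> complex^'v) \<Rightarrow> nat^'m \<Rightarrow> complex^'a" where
  "compose_fun H W m = (\<chi> i. tcompose (\<lambda>is. complex_of_real (pds is (\<lambda>z. H z $ i) 0)) W m)"

definition compose_deriv ::
    "(real^'v \<Rightarrow> real^'a) \<Rightarrow> (nat^'m \<Rightarrow> complex^'v) \<Rightarrow> nat^'m \<Rightarrow> complex^'v^'a" where
  "compose_deriv H W m =
     (\<chi> i j. tcompose (\<lambda>is. complex_of_real (pds is (pd j (\<lambda>z. H z $ i)) 0)) W m)"

text \<open>
  Taylor--Fourier expansion of \<open>H(\<phi>, W(p))\<close> for \<open>H\<close> that is \<open>2\<pi>\<close>-periodic in each component of \<open>\<phi>\<close>: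
  the Taylor coefficients of \<open>H(\<phi>, \<cdot>)\<close> at \<open>0\<close> are replaced by their Fourier coefficients in \<open>\<phi>\<close>.
\<close>

definition fourier_coeff :: "int^'q \<Rightarrow> (real^'q \<Rightarrow> real) \<Rightarrow> complex" where
  "fourier_coeff \<kappa> h =
     integral (cbox 0 (\<chi> j. 2 * pi))
       (\<lambda>\<phi>. complex_of_real (h \<phi>) * exp (- \<i> * complex_of_real (\<Sum>j\<in>UNIV. of_int (\<kappa> $ j) * \<phi> $ j)))
     / (2 * pi) ^ CARD('q)"

definition compose_phase ::
    "(real^'q \<Rightarrow> real^'v \<Rightarrow> real^'a) \<Rightarrow> (nat^'m \<Rightarrow> complex^'v) \<Rightarrow> int^'q \<Rightarrow> nat^'m \<Rightarrow> complex^'a" where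
  "compose_phase H W \<kappa> m =
     (\<chi> i. tcompose (\<lambda>is. fourier_coeff \<kappa> (\<lambda>\<phi>. pds is (\<lambda>z. H \<phi> z $ i) 0)) W m)"

end

theory Submission
  imports Defs
begin

text \<open>
  The second block row of the first-order system is the kinematic identity
  \<open>M \<cdot> d/dt (displacement) = M \<cdot> velocity\<close>: the blocks of \<open>B\<close> and \<open>A\<close> there are \<open>(M, 0)\<close> and
  \<open>(0, M)\<close>, and neither the nonlinearity \<open>F\<close> nor the forcing \<open>G\<close> has a component in it. So the
  lower half of the order-one invariance equation, read coefficient by coefficient, is
  \<open>M (Dw S + (\<partial>\<^sub>p x) R + (\<partial>\<^sub>\<phi> x) \<Omega>) = M v\<close> with \<open>v\<close> the velocity block of \<open>X\<close>,
  and the nonsingular \<open>M\<close> cancels.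

  Two facts turn this into a proof about formal series. Passing to the displacement block is
  selecting rows, which commutes with all the termwise operations and formal products involved
  (lemmas \<open>upper_tmatvec\<close>, \<open>upper_Dp\<close>, \<open>upper_Dphi\<close>). A component of a map that vanishes
  identically has only zero coefficients in its formal compositions
  (lemmas \<open>compose_deriv_component_zero\<close>, \<open>compose_phase_component_zero\<close>).
\<close>

lemma upper_vstack [simp]: "upper (vstack u v) = u"
  and lower_vstack [simp]: "lower (vstack u v) = v"
  by (simp_all add: upper_def lower_def vstack_def)

lemma vstack_upper_lower: "vstack (upper z) (lower z) = z"
  by (auto simp: vec_eq_iff vstack_def upper_def lower_def split: sum.split)

lemma upper_add: "upper (a + b) = upper a + upper b"
  and lower_add: "lower (a + b) = lower a + lower b"
  by (simp_all add: upper_def lower_def vec_eq_iff)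

lemma upper_sum: "upper (\<Sum>a\<in>A. h a) = (\<Sum>a\<in>A. upper (h a))"
  and lower_sum: "lower (\<Sum>a\<in>A. h a) = (\<Sum>a\<in>A. lower (h a))"
  by (simp_all add: upper_def lower_def vec_eq_iff)

text \<open>A matrix is a vector of rows, so the same selectors pick out blocks of rows of a matrix.\<close>

lemma upper_matrix_vector: "upper (P *v v) = upper P *v v"
  and lower_matrix_vector: "lower (P *v v) = lower P *v v"
  by (simp_all add: upper_def lower_def vec_eq_iff matrix_vector_mult_def)

lemma lower_block_matrix_mult:
  fixes P :: "'a::semiring_1^'n^'n"
  shows "lower (block_matrix P Q U V *v z) = U *v upper z + V *v lower z"
  by (metis block_matrix_mult_vstack lower_vstack vstack_upper_lower)

lemma cmat_block_matrix:
  "cmat (block_matrix P Q U V) = block_matrix (cmat P) (cmat Q) (cmat U) (cmat V)"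
  by (auto simp: cmat_def block_matrix_def vstack_def vec_eq_iff split: sum.split)

lemma cmat_zero [simp]: "cmat 0 = 0"
  by (simp add: cmat_def vec_eq_iff)

lemma cmat_mult: "cmat (P ** Q) = cmat P ** cmat Q"
  by (simp add: cmat_def matrix_matrix_mult_def vec_eq_iff)

lemma cmat_mat_1: "cmat (mat 1) = mat 1"
  by (simp add: cmat_def mat_def vec_eq_iff)

text \<open>The real inverse of \<open>M\<close> stays a left inverse over the complex numbers, since \<open>cmat\<close> is
  multiplicative.\<close>

lemma invertible_cmat_cancel:
  assumes "invertible M" and "cmat M *v a = cmat M *v b"
  shows "a = b"
proof -
  obtain N where "N ** M = mat 1"
    using assms(1) by (auto simp: invertible_def)
  then have "cmat N ** cmat M = mat 1"
    by (metis cmat_mult cmat_mat_1)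
  then show ?thesis
    using assms(2) by (metis matrix_vector_mul_assoc matrix_vector_mul_lid)
qed

lemma upper_tmatvec: "upper ((P \<star> v) m) = ((\<lambda>k. upper (P k)) \<star> v) m"
  and lower_tmatvec: "lower ((P \<star> v) m) = ((\<lambda>k. lower (P k)) \<star> v) m"
  by (simp_all add: tmatvec_def upper_sum lower_sum upper_matrix_vector lower_matrix_vector
      case_prod_beta)

lemma upper_Dp: "upper (Dp W m) = Dp (\<lambda>k. upper (W k)) m"
  by (simp add: upper_def Dp_def vec_eq_iff)

lemma upper_Dphi: "upper (Dphi X \<kappa> m) = Dphi (\<lambda>\<kappa> k. upper (X \<kappa> k)) \<kappa> m"
  by (simp add: upper_def Dphi_def vec_eq_iff)

lemma pd_zero: "pd j (\<lambda>z. 0) = (\<lambda>z. 0)"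
  by (simp add: pd_def fun_eq_iff)

lemma pds_zero: "pds is (\<lambda>z. 0) = (\<lambda>z. 0)"
  by (induction "is") (simp_all add: pds_def pd_zero)

lemma compose_deriv_component_zero:
  assumes "\<And>z. H z $ i = 0"
  shows "compose_deriv H W m $ i = 0"
  by (simp add: compose_deriv_def assms pd_zero pds_zero tcompose_def vec_eq_iff)

lemma compose_phase_component_zero:
  assumes "\<And>\<phi> z. H \<phi> z $ i = 0"
  shows "compose_phase H W \<kappa> m $ i = 0"
  by (simp add: compose_phase_def assms pds_zero tcompose_def fourier_coeff_def)

lemma lower_compose_deriv_sysF: "lower (compose_deriv (sysF f) W m) = 0"
  by (simp add: lower_def vec_eq_iff compose_deriv_component_zero sysF_def vstack_def)

lemma lower_compose_phase_sysG: "lower (compose_phase (sysG g) W \<kappa> m) = 0"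
  by (simp add: lower_def vec_eq_iff compose_phase_component_zero sysG_def vstack_def)

theorem lemma4:
  fixes M C K :: "real^'n^'n"
    and f :: "real^'n \<Rightarrow> real^'n \<Rightarrow> real^'n"
    and g :: "real^'q \<Rightarrow> real^'n \<Rightarrow> real^'n \<Rightarrow> real^'n"
    and \<Omega> :: "real^'q"
    and w wdot :: "nat^'m \<Rightarrow> complex^'n"
    and W :: "nat^'m \<Rightarrow> complex^('n + 'n)"
    and R :: "nat^'m \<Rightarrow> complex^'m"
    and x xdot :: "int^'q \<Rightarrow> nat^'m \<Rightarrow> complex^'n"
    and X :: "int^'q \<Rightarrow> nat^'m \<Rightarrow> complex^('n + 'n)"
    and S :: "int^'q \<Rightarrow> nat^'m \<Rightarrow> complex^'m"
  assumes "invertible M"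
    and g_periodic: "\<And>\<phi> j y v. g (\<phi> + axis j (2 * pi)) y v = g \<phi> y v"
    and W: "\<And>m. W m = vstack (w m) (wdot m)"
    and X: "\<And>\<kappa> m. X \<kappa> m = vstack (x \<kappa> m) (xdot \<kappa> m)"
    and "W 0 = 0" and "R 0 = 0"
    and order0: "\<And>m. cmat (sysB M C) *v (Dp W \<star> R) m
        = cmat (sysA M K) *v W m + compose_fun (sysF f) W m"
    and order1: "\<And>\<kappa> m. cmat (sysB M C) *v
          ((Dp W \<star> S \<kappa>) m + (Dp (X \<kappa>) \<star> R) m + Dphi X \<kappa> m *v cvec \<Omega>)
        = cmat (sysA M K) *v X \<kappa> m + (compose_deriv (sysF f) W \<star> X \<kappa>) m
          + compose_phase (sysG g) W \<kappa> m"
  shows "xdot \<kappa> m = (Dp w \<star> S \<kappa>) m + (Dp (x \<kappa>) \<star> R) m + Dphi x \<kappa> m *v cvec \<Omega>"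
proof -
  let ?Z = "(Dp W \<star> S \<kappa>) m + (Dp (X \<kappa>) \<star> R) m + Dphi X \<kappa> m *v cvec \<Omega>"
  have "((\<lambda>k. lower (compose_deriv (sysF f) W k)) \<star> X \<kappa>) m = 0"
    by (simp add: tmatvec_def lower_compose_deriv_sysF case_prod_beta)
  \<comment> \<open>the lower half of the order-one equation, in which only \<open>M\<close> survives\<close>
  then have "cmat M *v upper ?Z = cmat M *v xdot \<kappa> m"
    using arg_cong[OF order1[of \<kappa> m], of lower]
    by (simp add: sysA_def sysB_def cmat_block_matrix lower_block_matrix_mult lower_add
        lower_tmatvec lower_compose_phase_sysG X)
  then have "xdot \<kappa> m = upper ?Z"
    using invertible_cmat_cancel[OF \<open>invertible M\<close>] by metis
  also have "\<dots> = (Dp w \<star> S \<kappa>) m + (Dp (x \<kappa>) \<star> R) m + Dphi x \<kappa> m *v cvec \<Omega>"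
    by (simp add: upper_add upper_tmatvec upper_matrix_vector upper_Dp upper_Dphi W X)
  finally show ?thesis .
qed

end
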